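(* Suppose that $(\boldsymbol{x}^*,\boldsymbol{m}^* )$ is a pure strategy Nash equilibrium such that $0<x^*_\ell<q^*$ for some player $\ell$. Then $(\boldsymbol{x}^*,\boldsymbol{m}^* )$ is not action stable.
   Context: Setting: $G=(V,E)$ is a finite connected simple undirected graph with $V=\{1,\dots,n\}$, $N_G(i)$ is the neighbourhood of $i$, $d_G(i)=|N_G(i)|$, and $\kappa:V\to\mathbb{N}_0$ is a capacity function. Each player $i\in V$ chooses an action $x_i\in X=\{0,1,\dots,\bar x\}$ and a nomination $m_i\subseteq N_G(i)$ with $|m_i|=\min\{\kappa(i),d_G(i)\}$. Payoffs are $U_i(\boldsymbol{x},\boldsymbol{m})=f\big(x_i+\sum_{\{j\in N_G(i):\, i\in m_j\}}x_j\big)-c\,x_i$, with $f:\mathbb{N}_0\to\mathbb{R}$, $c>0$, and $q^*\in X$ a positive integer such that $q^*\in\operatorname{argmax}_{x\in X}(f(x)-cx)$ and $f(x)-cx$ is non-increasing for $x\ge q^*$. Given a nomination profile $\boldsymbol{m}$ and action profile $\boldsymbol{x}\in X^n$, the best-action response of player $i$ is $\mathcal{B}_{i,\boldsymbol{m}}(\boldsymbol{x})=\max\{q^*-\sum_{\{j\in N_G(i):\, i\in m_j\}}x_j,\;0\}$. Standing convention: this is the unique action in $X$ maximising $U_i$ against the other players' choices, so that $(\boldsymbol{x}^*,\boldsymbol{m}^* )$ is a pure strategy Nash equilibrium (no player can increase $U_i$ by changing $(x_i,m_i)$) if and only if $x_i^*=\mathcal{B}_{i,\boldsymbol{m}^*}(\boldsymbol{x}^*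 )$ for all $i$. Let $\mathcal{B}_{\boldsymbol{m}}(\boldsymbol{x})=(\mathcal{B}_{1,\boldsymbol{m}}(\boldsymbol{x}),\dots,\mathcal{B}_{n,\boldsymbol{m}}(\boldsymbol{x}))$. The best-action evolution of $\boldsymbol{x}$ (with $\boldsymbol{m}$ fixed) is $\boldsymbol{x}^{(0)}=\boldsymbol{x}$, $\boldsymbol{x}^{(t)}=\mathcal{B}_{\boldsymbol{m}}(\boldsymbol{x}^{(t-1)})$ for $t\ge1$. It settles in $\boldsymbol{y}$ if there is $t_0$ with $\boldsymbol{x}^{(t)}=\boldsymbol{y}$ for all $t\ge t_0$. A profile $(\boldsymbol{x},\boldsymbol{m})$ is action stable if there exists $\delta\ge1$ such that for every individual $i$ and every action profile $\boldsymbol{x}'\in X^n$ with $x'_j=x_j$ for all $j\ne i$ and $|x'_i-x_i|\le\delta$, the best-action evolution of $\boldsymbol{x}'$ (with $\boldsymbol{m}$ fixed) settles in $\boldsymbol{x}$. *)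

theory Defs
  imports Complex_Main "Graph_Theory.Pair_Digraph" "Graph_Theory.Digraph_Component"
begin

text \<open>
  A finite simple undirected graph is a \<^locale>\<open>pair_graph\<close>, i.e. a finite loop-free
  symmetric set of arcs.  Action and nomination profiles are total functions on \<^typ>\<open>nat\<close>;
  only their values at vertices of the graph carry meaning.
\<close>

definition nbhd :: "nat pair_pre_digraph \<Rightarrow> nat \<Rightarrow> nat set" where
  "nbhd G i = {j. (i, j) \<in> parcs G}"

definition deg :: "nat pair_pre_digraph \<Rightarrow> nat \<Rightarrow> nat" where
  "deg G i = card (nbhd G i)"

definition nominations :: "nat pair_pre_digraph \<Rightarrow> (nat \<Rightarrow> nat) \<Rightarrow> nat \<Rightarrow> nat set set" where
  "nominations G \<kappa> i = {S. S \<subseteq> nbhd G i \<and> card S = min (\<kappa> i) (deg G i)}"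

definition nomination_profile ::
    "nat pair_pre_digraph \<Rightarrow> (nat \<Rightarrow> nat) \<Rightarrow> (nat \<Rightarrow> nat set) \<Rightarrow> bool" where
  "nomination_profile G \<kappa> m \<longleftrightarrow> (\<forall>i\<in>pverts G. m i \<in> nominations G \<kappa> i)"

definition action_profile :: "nat pair_pre_digraph \<Rightarrow> nat \<Rightarrow> (nat \<Rightarrow> nat) \<Rightarrow> bool" where
  "action_profile G xbar x \<longleftrightarrow> (\<forall>i\<in>pverts G. x i \<in> {0..xbar})"

definition received :: "nat pair_pre_digraph \<Rightarrow> (nat \<Rightarrow> nat set) \<Rightarrow> (nat \<Rightarrow> nat) \<Rightarrow> nat \<Rightarrow> nat" where
  "received G m x i = (\<Sum>j | j \<in> nbhd G i \<and> i \<in> m j. x j)"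

definition payoff ::
    "nat pair_pre_digraph \<Rightarrow> (nat \<Rightarrow> real) \<Rightarrow> real \<Rightarrow> nat \<Rightarrow> (nat \<Rightarrow> nat) \<Rightarrow> (nat \<Rightarrow> nat set) \<Rightarrow> real" where
  "payoff G f c i x m = f (x i + received G m x i) - c * real (x i)"

definition nash_equilibrium ::
    "nat pair_pre_digraph \<Rightarrow> (nat \<Rightarrow> nat) \<Rightarrow> nat \<Rightarrow> (nat \<Rightarrow> real) \<Rightarrow> real \<Rightarrow>
     (nat \<Rightarrow> nat) \<Rightarrow> (nat \<Rightarrow> nat set) \<Rightarrow> bool" where
  "nash_equilibrium G \<kappa> xbar f c x m \<longleftrightarrow>
     action_profile G xbar x \<and> nomination_profile G \<kappa> m \<and>
     (\<forall>i\<in>pverts G. \<forall>a\<in>{0..xbar}. \<forall>S\<in>nominations G \<kappa> i.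
        payoff G f c i (x(i := a)) (m(i := S)) \<le> payoff G f c i x m)"

text \<open>The subtraction on \<^typ>\<open>nat\<close> is truncated, so it already is the maximum with 0.\<close>

definition best_action ::
    "nat pair_pre_digraph \<Rightarrow> nat \<Rightarrow> (nat \<Rightarrow> nat set) \<Rightarrow> (nat \<Rightarrow> nat) \<Rightarrow> (nat \<Rightarrow> nat)" where
  "best_action G q m x = (\<lambda>i. q - received G m x i)"

definition best_action_unique ::
    "nat pair_pre_digraph \<Rightarrow> (nat \<Rightarrow> nat) \<Rightarrow> nat \<Rightarrow> (nat \<Rightarrow> real) \<Rightarrow> real \<Rightarrow> nat \<Rightarrow> bool" where
  "best_action_unique G \<kappa> xbar f c q \<longleftrightarrow>
     (\<forall>m x. nomination_profile G \<kappa> m \<longrightarrow> action_profile G xbar x \<longrightarrow>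
       (\<forall>i\<in>pverts G. \<forall>a.
          is_arg_max (\<lambda>b. payoff G f c i (x(i := b)) m) (\<lambda>b. b \<in> {0..xbar}) a
          \<longleftrightarrow> a = best_action G q m x i))"

definition settles_in ::
    "nat pair_pre_digraph \<Rightarrow> nat \<Rightarrow> (nat \<Rightarrow> nat set) \<Rightarrow> (nat \<Rightarrow> nat) \<Rightarrow> (nat \<Rightarrow> nat) \<Rightarrow> bool" where
  "settles_in G q m x y \<longleftrightarrow>
     (\<exists>t0. \<forall>t\<ge>t0. \<forall>i\<in>pverts G. (best_action G q m ^^ t) x i = y i)"

definition action_stable ::
    "nat pair_pre_digraph \<Rightarrow> nat \<Rightarrow> nat \<Rightarrow> (nat \<Rightarrow> nat) \<Rightarrow> (nat \<Rightarrow> nat set) \<Rightarrow> bool" where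
  "action_stable G xbar q x m \<longleftrightarrow>
     (\<exists>\<delta>::nat. \<delta> \<ge> 1 \<and>
       (\<forall>i\<in>pverts G. \<forall>x'. action_profile G xbar x' \<longrightarrow>
          (\<forall>j\<in>pverts G. j \<noteq> i \<longrightarrow> x' j = x j) \<longrightarrow>
          \<bar>int (x' i) - int (x i)\<bar> \<le> int \<delta> \<longrightarrow>
          settles_in G q m x' x))"

end

theory Submission
  imports Defs
begin

text \<open>
  The map \<^const>\<open>best_action\<close> reverses the order, and the equilibrium \<open>x\<close> is one of its fixed
  points.  A player \<open>l\<close> with \<open>0 < x l < q\<close> receives a positive amount smaller than \<open>q\<close>, hence is
  nominated by a neighbour \<open>j\<close> with \<open>0 < x j < q\<close>.  So for every \<open>T\<close> there is a walk of length
  \<open>T\<close> through such players that ends in \<open>l\<close>.  Lowering the action of the first player on the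
  walk by 1 creates a deviation, alternately downwards and upwards, that moves along the walk and
  reaches \<open>l\<close> exactly at time \<open>T\<close>.  As there are finitely many players, some \<open>T\<close> exceeds all
  settling times of these perturbations, contradicting stability.
\<close>

text \<open>The disjunction is there because \<open>best_action\<close> flips the sign of a
  deviation. Requiring one common sign on all of \<open>V\<close> prevents deviations of several
  nominators from cancelling in a sum.\<close>

definition deviates :: "nat set \<Rightarrow> (nat \<Rightarrow> nat) \<Rightarrow> (nat \<Rightarrow> nat) \<Rightarrow> nat \<Rightarrow> bool" where
  "deviates V x y i \<longleftrightarrow>
     (\<forall>k\<in>V. y k \<le> x k) \<and> y i < x i \<or> (\<forall>k\<in>V. x k \<le> y k) \<and> x i < y i"

lemma nbhd_subset:
  assumes "pair_graph G"
  shows "nbhd G i \<subseteq> pverts G"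
proof -
  interpret pair_graph G by (rule assms)
  show ?thesis by (auto simp: nbhd_def dest: in_arcsD2)
qed

lemma finite_nbhd:
  assumes "pair_graph G"
  shows "finite (nbhd G i)"
proof -
  interpret pair_graph G by (rule assms)
  show ?thesis using nbhd_subset[OF assms] pair_finite_verts by (rule finite_subset)
qed

lemma received_mono:
  assumes "pair_graph G" and "\<forall>k\<in>pverts G. y k \<le> z k"
  shows "received G m y i \<le> received G m z i"
  unfolding received_def using assms(2) nbhd_subset[OF assms(1)] by (intro sum_mono) blast

lemma received_strict_mono:
  assumes "pair_graph G" and "\<forall>k\<in>pverts G. y k \<le> z k"
    and "j \<in> nbhd G i" and "i \<in> m j" and "y j < z j"
  shows "received G m y i < received G m z i"
  unfolding received_def
proof (rule sum_strict_mono_ex1)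
  show "finite {j \<in> nbhd G i. i \<in> m j}"
    using finite_nbhd[OF assms(1)] by simp
qed (use assms nbhd_subset[OF assms(1)] in blast)+

text \<open>Keeping the nomination \<open>m i\<close> turns the equilibrium condition into a
  comparison of actions alone, so \<open>x i\<close> is a maximiser, and the maximiser is
  unique.\<close>

lemma nash_equilibrium_fixed_point:
  assumes nash: "nash_equilibrium G \<kappa> xbar f c x m"
    and uniq: "best_action_unique G \<kappa> xbar f c q" and i: "i \<in> pverts G"
  shows "best_action G q m x i = x i"
proof -
  have xm: "action_profile G xbar x" "nomination_profile G \<kappa> m"
    using nash by (auto simp: nash_equilibrium_def)
  have mi: "m i \<in> nominations G \<kappa> i"
    using xm(2) i by (simp add: nomination_profile_def)
  have "payoff G f c i (x(i := a)) m \<le> payoff G f c i x m" if "a \<in> {0..xbar}" for a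
  proof -
    have "payoff G f c i (x(i := a)) (m(i := m i)) \<le> payoff G f c i x m"
      using nash i mi that unfolding nash_equilibrium_def by blast
    then show ?thesis by simp
  qed
  then have "is_arg_max (\<lambda>b. payoff G f c i (x(i := b)) m) (\<lambda>b. b \<in> {0..xbar}) (x i)"
    using xm(1) i by (fastforce simp: is_arg_max_def action_profile_def not_less)
  then show ?thesis
    using uniq xm i unfolding best_action_unique_def by metis
qed

text \<open>The strict change at \<open>j\<close> makes the amount received by \<open>i\<close>
  change strictly. Since \<open>0 < x i\<close>, that amount is below \<open>q\<close> at
  \<open>x\<close>, so truncated subtraction does not hide the change.\<close>

lemma deviates_best_action:
  assumes G: "pair_graph G"
    and fixed: "\<And>i. i \<in> pverts G \<Longrightarrow> best_action G q m x i = x i"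
    and i: "i \<in> pverts G" "0 < x i"
    and j: "j \<in> nbhd G i" "i \<in> m j"
    and dev: "deviates (pverts G) x y j"
  shows "deviates (pverts G) x (best_action G q m y) i"
proof -
  have x_eq: "x k = q - received G m x k" if "k \<in> pverts G" for k
    using fixed[OF that] by (simp add: best_action_def)
  from dev consider
      (below) "\<forall>k\<in>pverts G. y k \<le> x k" "y j < x j"
    | (above) "\<forall>k\<in>pverts G. x k \<le> y k" "x j < y j"
    by (auto simp: deviates_def)
  then show ?thesis
  proof cases
    case below
    have "\<forall>k\<in>pverts G. x k \<le> best_action G q m y k"
      using received_mono[OF G below(1)] by (auto simp: best_action_def x_eq intro: diff_le_mono2)
    moreover have "x i < best_action G q m y i"
      using received_strict_mono[of G y x j i m, OF G below(1) j below(2)] x_eq[OF i(1)] i(2)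
      by (simp add: best_action_def)
    ultimately show ?thesis by (simp add: deviates_def)
  next
    case above
    have "\<forall>k\<in>pverts G. best_action G q m y k \<le> x k"
      using received_mono[OF G above(1)] by (auto simp: best_action_def x_eq intro: diff_le_mono2)
    moreover have "best_action G q m y i < x i"
      using received_strict_mono[of G x y j i m, OF G above(1) j above(2)] x_eq[OF i(1)] i(2)
      by (simp add: best_action_def)
    ultimately show ?thesis by (simp add: deviates_def)
  qed
qed

text \<open>Here \<open>x i < q\<close> forces some nominator to be active, while
  \<open>0 < x i\<close> keeps the whole sum, hence each summand, below \<open>q\<close>.\<close>

lemma intermediate_nominator:
  assumes G: "pair_graph G" and fixed: "best_action G q m x i = x i"
    and i: "0 < x i" "x i < q"
  obtains j where "j \<in> nbhd G i" "i \<in> m j" "0 < x j" "x j < q"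
proof -
  let ?N = "{j \<in> nbhd G i. i \<in> m j}"
  have fin: "finite ?N" using finite_nbhd[OF G] by simp
  have rec: "received G m x i = q - x i"
    using fixed i by (simp add: best_action_def)
  then have "(\<Sum>j\<in>?N. x j) \<noteq> 0"
    using i by (simp add: received_def)
  then obtain j where j: "j \<in> ?N" "x j \<noteq> 0"
    by (meson sum.neutral)
  have "x j \<le> received G m x i"
    unfolding received_def using j(1) fin by (intro member_le_sum) auto
  then have "x j < q" using rec i by simp
  with j that show thesis by blast
qed

text \<open>The walk is built backwards from \<open>i\<close>, so the start \<open>s\<close> may
  depend on \<open>T\<close>.\<close>

lemma deviation_reaches_intermediate_player:
  assumes G: "pair_graph G"
    and fixed: "\<And>i. i \<in> pverts G \<Longrightarrow> best_action G q m x i = x i"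
    and "i \<in> pverts G" "0 < x i" "x i < q"
  shows "\<exists>s\<in>pverts G. deviates (pverts G) x ((best_action G q m ^^ T) (x(s := x s - 1))) i"
  using assms(3-)
proof (induction T arbitrary: i)
  case 0
  \<comment> \<open>Because \<open>0 < x i\<close>, subtracting 1 is a genuine decrease.\<close>
  then show ?case by (intro bexI[of _ i]) (simp_all add: deviates_def)
next
  case (Suc T)
  obtain j where j: "j \<in> nbhd G i" "i \<in> m j" "0 < x j" "x j < q"
    using intermediate_nominator[OF G fixed[OF Suc.prems(1)] Suc.prems(2,3)] by blast
  then have "j \<in> pverts G"
    using nbhd_subset[OF G] by blast
  then obtain s where "s \<in> pverts G"
    and "deviates (pverts G) x ((best_action G q m ^^ T) (x(s := x s - 1))) j"
    using Suc.IH j by blast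
  then have "deviates (pverts G) x ((best_action G q m ^^ Suc T) (x(s := x s - 1))) i"
    using deviates_best_action[OF G fixed Suc.prems(1,2) j(1,2)] by simp
  with \<open>s \<in> pverts G\<close> show ?case by blast
qed

theorem proposition2:
  fixes G :: "nat pair_pre_digraph"
    and n xbar q l :: nat
    and \<kappa> x :: "nat \<Rightarrow> nat"
    and f :: "nat \<Rightarrow> real"
    and c :: real
    and m :: "nat \<Rightarrow> nat set"
  assumes "pair_graph G"
    and "Digraph_Component.connected (with_proj G)"
    and "pverts G = {1..n}"
    and "c > 0"
    and "0 < q"
    and "is_arg_max (\<lambda>s. f s - c * real s) (\<lambda>s. s \<in> {0..xbar}) q"
    and "antimono_on {q..} (\<lambda>s. f s - c * real s)"
    and "best_action_unique G \<kappa> xbar f c q"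
    and "nash_equilibrium G \<kappa> xbar f c x m"
    and "l \<in> pverts G"
    and "0 < x l"
    and "x l < q"
  shows "\<not> action_stable G xbar q x m"
proof
  assume "action_stable G xbar q x m"
  then obtain \<delta> :: nat where \<delta>: "\<delta> \<ge> 1"
    and stable: "\<And>i x'. \<lbrakk>i \<in> pverts G; action_profile G xbar x';
      \<forall>j\<in>pverts G. j \<noteq> i \<longrightarrow> x' j = x j; \<bar>int (x' i) - int (x i)\<bar> \<le> int \<delta>\<rbrakk>
      \<Longrightarrow> settles_in G q m x' x"
    unfolding action_stable_def by blast
  let ?y = "\<lambda>s t. (best_action G q m ^^ t) (x(s := x s - 1))"
  have x: "action_profile G xbar x"
    using assms(9) by (simp add: nash_equilibrium_def)
  have "\<forall>\<^sub>F t in sequentially. \<forall>i\<in>pverts G. ?y s t i = x i" if s: "s \<in> pverts G" for s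
  proof -
    have "action_profile G xbar (x(s := x s - 1))"
      using x by (auto simp: action_profile_def intro: le_trans[OF diff_le_self])
    then have "settles_in G q m (x(s := x s - 1)) x"
      by (rule stable[OF s]) (use \<delta> in auto)
    then show ?thesis
      by (simp add: settles_in_def eventually_sequentially)
  qed
  \<comment> \<open>Finiteness of the player set gives one settling time for all starts
    \<open>s\<close>; this is needed since the start reaching \<open>l\<close> is known only after
    \<open>T\<close> is fixed.\<close>
  then have "\<forall>\<^sub>F t in sequentially. \<forall>s\<in>pverts G. \<forall>i\<in>pverts G. ?y s t i = x i"
    using assms(3) by (intro eventually_ball_finite) auto
  then obtain T where T: "\<forall>s\<in>pverts G. \<forall>i\<in>pverts G. ?y s T i = x i"
    by (auto simp: eventually_sequentially)
  obtain s where "s \<in> pverts G" "deviates (pverts G) x (?y s T) l"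
    using deviation_reaches_intermediate_player[OF assms(1)
        nash_equilibrium_fixed_point[OF assms(9,8)] assms(10-12)] by blast
  with T assms(10) show False
    by (auto simp: deviates_def)
qed

end
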